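(* For every set operad $\mathcal{O}$, let $\eta_{\mathcal{O}}\colon\mathcal{O}\to\wp\mathcal{O}$ be given by $a\mapsto\{a\}$ and let $\mu_{\mathcal{O}}\colon\wp^2\mathcal{O}\to\wp\mathcal{O}$ be given by $\mathcal{A}\mapsto\bigcup_{A\in\mathcal{A}}A$. Then the unit $\eta$ and the product $\mu$ endow the endofunctor $\wp$ of the category $\mathsf{Op}(\mathsf{Set})$ of set operads with a monad structure. Likewise, the same formulas (restricted to non-empty subsets) endow the endofunctor $\overline{\wp}$ of $\mathsf{Op}(\mathsf{Set})$ with a monad structure.
   Context: A set operad is a symmetric operad in the monoidal category of sets with Cartesian product, described by $\mathbb{S}_n$-sets $\mathcal{O}(n)$, $n\in\mathbb{N}$, and partial compositions $\circ_i\colon\mathcal{O}(n)\times\mathcal{O}(m)\to\mathcal{O}(n+m-1)$, $1\le i\le n$, with unit $\mathrm{id}\in\mathcal{O}(1)$. For a set $S$, $\wp(S)$ is the set of subsets of $S$ and $\overline{\wp}(S)=\wp(S)\setminus\{\emptyset\}$. The endofunctor $\wp$ of $\mathsf{Op}(\mathsf{Set})$ sends $(\mathcal{O},\{\circ_i\})$ to the operad $\wp\mathcal{O}$ with $(\wp\mathcal{O})(n)=\wp(\mathcal{O}(n))$, the induced symmetric group actions, unit $\{\mathrm{id}\}$, and compositions $A\circ_i B=\{a\circ_i b\mid a\in A,\ b\in B\}$; on morphisms it acts by direct image. The endofunctor $\overline{\wp}$ is defined in the same way with $(\overline{\wp}\mathcal{O})(n)=\overline{\wp}(\mathcal{O}(n))$.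 *)

theory Defs
  imports "HOL-Combinatorics.Permutations" "HOL-Library.FuncSet"
begin

section \<open>Set operads\<close>

record 'a operad_data =
  ops :: "nat \<Rightarrow> 'a set"
  act :: "nat \<Rightarrow> 'a \<Rightarrow> (nat \<Rightarrow> nat) \<Rightarrow> 'a"
  pcomp :: "nat \<Rightarrow> nat \<Rightarrow> nat \<Rightarrow> 'a \<Rightarrow> 'a \<Rightarrow> 'a"
  ident :: "'a"

text \<open>
  The term \<open>act X n a s\<close> is the right action of a permutation \<open>s\<close> of \<open>{1..n}\<close> on \<open>a\<close> in \<open>ops X n\<close>,
  and \<open>pcomp X n m i a b\<close> is the partial composition of \<open>a\<close> in \<open>ops X n\<close> with \<open>b\<close> in \<open>ops X m\<close>
  at the \<open>i\<close>-th input.  Values outside these ranges are irrelevant.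

  Conventions are those of the endomorphism operad with
  \<open>(f \<cdot> s)(x 1, \<dots>, x n) = f(x (s\<^sup>-\<^sup>1 1), \<dots>, x (s\<^sup>-\<^sup>1 n))\<close>: the \<open>k\<close>-th input of \<open>f \<cdot> s\<close> is the
  \<open>s k\<close>-th input of \<open>f\<close>.  Accordingly \<open>block_perm m i s t\<close> sends the position of an input of
  \<open>(a \<cdot> s) \<circ>\<^sub>i (b \<cdot> t)\<close>, where \<open>b\<close> has arity \<open>m\<close>, to its position in \<open>a \<circ>\<^bsub>s i\<^esub> b\<close>.
  It fixes every point outside \<open>{1..n + m - 1}\<close> if \<open>s\<close> permutes \<open>{1..n}\<close> and \<open>i\<close> is in \<open>{1..n}\<close>.
\<close>

definition block_perm ::
    "nat \<Rightarrow> nat \<Rightarrow> (nat \<Rightarrow> nat) \<Rightarrow> (nat \<Rightarrow> nat) \<Rightarrow> nat \<Rightarrow> nat" where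
  "block_perm m i s t k =
     (if i \<le> k \<and> k < i + m then s i + t (k - i + 1) - 1
      else let j = (if k < i then k else k + 1 - m)
           in if s j < s i then s j else s j + m - 1)"

definition set_operad :: "'a operad_data \<Rightarrow> bool" where
  "set_operad X \<longleftrightarrow>
    \<comment> \<open>right actions of the symmetric groups\<close>
    (\<forall>n. \<forall>a \<in> ops X n. \<forall>s. s permutes {1..n} \<longrightarrow> act X n a s \<in> ops X n) \<and>
    (\<forall>n. \<forall>a \<in> ops X n. act X n a id = a) \<and>
    (\<forall>n. \<forall>a \<in> ops X n. \<forall>s t. s permutes {1..n} \<and> t permutes {1..n} \<longrightarrow>
        act X n a (s \<circ> t) = act X n (act X n a s) t) \<and>
    \<comment> \<open>unit and partial compositions\<close>
    ident X \<in> ops X 1 \<and>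
    (\<forall>n m. \<forall>i \<in> {1..n}. \<forall>a \<in> ops X n. \<forall>b \<in> ops X m.
        pcomp X n m i a b \<in> ops X (n + m - 1)) \<and>
    (\<forall>n. \<forall>a \<in> ops X n. pcomp X 1 n 1 (ident X) a = a) \<and>
    (\<forall>n. \<forall>i \<in> {1..n}. \<forall>a \<in> ops X n. pcomp X n 1 i a (ident X) = a) \<and>
    \<comment> \<open>sequential associativity\<close>
    (\<forall>n m l. \<forall>i \<in> {1..n}. \<forall>j \<in> {1..m}. \<forall>a \<in> ops X n. \<forall>b \<in> ops X m. \<forall>c \<in> ops X l.
        pcomp X (n + m - 1) l (i + j - 1) (pcomp X n m i a b) c =
        pcomp X n (m + l - 1) i a (pcomp X m l j b c)) \<and>
    \<comment> \<open>parallel associativity\<close>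
    (\<forall>n m l. \<forall>i \<in> {1..n}. \<forall>k \<in> {1..n}. i < k \<longrightarrow>
      (\<forall>a \<in> ops X n. \<forall>b \<in> ops X m. \<forall>c \<in> ops X l.
        pcomp X (n + m - 1) l (k + m - 1) (pcomp X n m i a b) c =
        pcomp X (n + l - 1) m i (pcomp X n l k a c) b)) \<and>
    \<comment> \<open>equivariance\<close>
    (\<forall>n m. \<forall>i \<in> {1..n}. \<forall>a \<in> ops X n. \<forall>b \<in> ops X m. \<forall>s t.
      s permutes {1..n} \<and> t permutes {1..m} \<longrightarrow>
        pcomp X n m i (act X n a s) (act X m b t) =
        act X (n + m - 1) (pcomp X n m (s i) a b) (block_perm m i s t))"


section \<open>The category of set operads\<close>

text \<open>
  Morphisms are families of extensional functions (equal to \<open>undefined\<close> outside the domain), so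
  that equality of morphisms is equality in the logic.  The objects of the category are the set
  operads over all types; source and target of a morphism may live over different types.
\<close>

definition op_hom :: "'a operad_data \<Rightarrow> 'b operad_data \<Rightarrow> (nat \<Rightarrow> 'a \<Rightarrow> 'b) set" where
  "op_hom X Y = {f.
    (\<forall>n. f n \<in> ops X n \<rightarrow>\<^sub>E ops Y n) \<and>
    (\<forall>n. \<forall>a \<in> ops X n. \<forall>s. s permutes {1..n} \<longrightarrow> f n (act X n a s) = act Y n (f n a) s) \<and>
    f 1 (ident X) = ident Y \<and>
    (\<forall>n m. \<forall>i \<in> {1..n}. \<forall>a \<in> ops X n. \<forall>b \<in> ops X m.
        f (n + m - 1) (pcomp X n m i a b) = pcomp Y n m i (f n a) (f m b))}"

definition op_id :: "'a operad_data \<Rightarrow> nat \<Rightarrow> 'a \<Rightarrow> 'a" where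
  "op_id X n = (\<lambda>a \<in> ops X n. a)"

definition op_compose ::
    "'a operad_data \<Rightarrow> (nat \<Rightarrow> 'b \<Rightarrow> 'c) \<Rightarrow> (nat \<Rightarrow> 'a \<Rightarrow> 'b) \<Rightarrow> nat \<Rightarrow> 'a \<Rightarrow> 'c" where
  "op_compose X g f n = compose (ops X n) (g n) (f n)"

text \<open>
  The data of an endofunctor is a function on operads and a function on morphisms (with
  the source as an additional argument), both polymorphic.  As a definition cannot
  take polymorphic arguments, the following predicates take one argument for each type instance
  needed; they are meant to be applied to instances of the same polymorphic constants.
\<close>

definition op_endofunctor ::
    "('a operad_data \<Rightarrow> 'fa operad_data) \<Rightarrow> ('b operad_data \<Rightarrow> 'fb operad_data) \<Rightarrow>
     ('a operad_data \<Rightarrow> (nat \<Rightarrow> 'a \<Rightarrow> 'a) \<Rightarrow> nat \<Rightarrow> 'fa \<Rightarrow> 'fa) \<Rightarrow>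
     ('a operad_data \<Rightarrow> (nat \<Rightarrow> 'a \<Rightarrow> 'b) \<Rightarrow> nat \<Rightarrow> 'fa \<Rightarrow> 'fb) \<Rightarrow>
     ('b operad_data \<Rightarrow> (nat \<Rightarrow> 'b \<Rightarrow> 'c) \<Rightarrow> nat \<Rightarrow> 'fb \<Rightarrow> 'fc) \<Rightarrow>
     ('a operad_data \<Rightarrow> (nat \<Rightarrow> 'a \<Rightarrow> 'c) \<Rightarrow> nat \<Rightarrow> 'fa \<Rightarrow> 'fc) \<Rightarrow> bool" where
  "op_endofunctor Fa Fb Maa Mab Mbc Mac \<longleftrightarrow>
    (\<forall>X. set_operad X \<longrightarrow> set_operad (Fa X)) \<and>
    (\<forall>X Y. \<forall>f \<in> op_hom X Y. set_operad X \<and> set_operad Y \<longrightarrow>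
        Mab X f \<in> op_hom (Fa X) (Fb Y)) \<and>
    (\<forall>X. set_operad X \<longrightarrow> Maa X (op_id X) = op_id (Fa X)) \<and>
    (\<forall>X Y Z. \<forall>f \<in> op_hom X Y. \<forall>g \<in> op_hom Y Z.
        set_operad X \<and> set_operad Y \<and> set_operad Z \<longrightarrow>
        Mac X (op_compose X g f) = op_compose (Fa X) (Mbc Y g) (Mab X f))"

definition op_nat_trans ::
    "('a operad_data \<Rightarrow> 'fa operad_data) \<Rightarrow> ('b operad_data \<Rightarrow> 'fb operad_data) \<Rightarrow>
     ('a operad_data \<Rightarrow> (nat \<Rightarrow> 'a \<Rightarrow> 'b) \<Rightarrow> nat \<Rightarrow> 'fa \<Rightarrow> 'fb) \<Rightarrow>
     ('a operad_data \<Rightarrow> 'ga operad_data) \<Rightarrow> ('b operad_data \<Rightarrow> 'gb operad_data) \<Rightarrow>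
     ('a operad_data \<Rightarrow> (nat \<Rightarrow> 'a \<Rightarrow> 'b) \<Rightarrow> nat \<Rightarrow> 'ga \<Rightarrow> 'gb) \<Rightarrow>
     ('a operad_data \<Rightarrow> nat \<Rightarrow> 'fa \<Rightarrow> 'ga) \<Rightarrow> ('b operad_data \<Rightarrow> nat \<Rightarrow> 'fb \<Rightarrow> 'gb) \<Rightarrow> bool" where
  "op_nat_trans Fa Fb FM Ga Gb GM \<alpha>a \<alpha>b \<longleftrightarrow>
    (\<forall>X. set_operad X \<longrightarrow> \<alpha>a X \<in> op_hom (Fa X) (Ga X)) \<and>
    (\<forall>Y. set_operad Y \<longrightarrow> \<alpha>b Y \<in> op_hom (Fb Y) (Gb Y)) \<and>
    (\<forall>X Y. \<forall>f \<in> op_hom X Y. set_operad X \<and> set_operad Y \<longrightarrow>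
        op_compose (Fa X) (\<alpha>b Y) (FM X f) = op_compose (Fa X) (GM X f) (\<alpha>a X))"

text \<open>
  Associativity \<open>\<mu> \<circ> F\<mu> = \<mu> \<circ> \<mu>F\<close> and the unit laws \<open>\<mu> \<circ> F\<eta> = id = \<mu> \<circ> \<eta>F\<close>, where \<open>F1\<close>, \<open>F2\<close>, \<open>F3\<close>
  are the instances of \<open>F\<close> at the types of \<open>X\<close>, \<open>F X\<close>, \<open>F (F X)\<close>, and similarly for \<open>\<eta>\<close> and \<open>\<mu>\<close>.
\<close>

definition op_monad_laws ::
    "('a operad_data \<Rightarrow> 'b operad_data) \<Rightarrow> ('b operad_data \<Rightarrow> 'c operad_data) \<Rightarrow>
     ('c operad_data \<Rightarrow> 'd operad_data) \<Rightarrow>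
     ('a operad_data \<Rightarrow> (nat \<Rightarrow> 'a \<Rightarrow> 'b) \<Rightarrow> nat \<Rightarrow> 'b \<Rightarrow> 'c) \<Rightarrow>
     ('c operad_data \<Rightarrow> (nat \<Rightarrow> 'c \<Rightarrow> 'b) \<Rightarrow> nat \<Rightarrow> 'd \<Rightarrow> 'c) \<Rightarrow>
     ('a operad_data \<Rightarrow> nat \<Rightarrow> 'a \<Rightarrow> 'b) \<Rightarrow> ('b operad_data \<Rightarrow> nat \<Rightarrow> 'b \<Rightarrow> 'c) \<Rightarrow>
     ('a operad_data \<Rightarrow> nat \<Rightarrow> 'c \<Rightarrow> 'b) \<Rightarrow> ('b operad_data \<Rightarrow> nat \<Rightarrow> 'd \<Rightarrow> 'c) \<Rightarrow> bool" where
  "op_monad_laws F1 F2 F3 M\<eta> M\<mu> \<eta>1 \<eta>2 \<mu>1 \<mu>2 \<longleftrightarrow>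
    (\<forall>X. set_operad X \<longrightarrow>
      op_compose (F3 (F2 (F1 X))) (\<mu>1 X) (M\<mu> (F2 (F1 X)) (\<mu>1 X)) =
        op_compose (F3 (F2 (F1 X))) (\<mu>1 X) (\<mu>2 (F1 X)) \<and>
      op_compose (F1 X) (\<mu>1 X) (M\<eta> X (\<eta>1 X)) = op_id (F1 X) \<and>
      op_compose (F1 X) (\<mu>1 X) (\<eta>2 (F1 X)) = op_id (F1 X))"


section \<open>Powerset operads\<close>

definition pow_operad :: "'a operad_data \<Rightarrow> 'a set operad_data" where
  "pow_operad X = \<lparr>
     ops = (\<lambda>n. Pow (ops X n)),
     act = (\<lambda>n A s. (\<lambda>a. act X n a s) ` A),
     pcomp = (\<lambda>n m i A B. {pcomp X n m i a b |a b. a \<in> A \<and> b \<in> B}),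
     ident = {ident X}\<rparr>"

definition pow_map :: "'a operad_data \<Rightarrow> (nat \<Rightarrow> 'a \<Rightarrow> 'b) \<Rightarrow> nat \<Rightarrow> 'a set \<Rightarrow> 'b set" where
  "pow_map X f n = (\<lambda>A \<in> ops (pow_operad X) n. f n ` A)"

definition pow_unit :: "'a operad_data \<Rightarrow> nat \<Rightarrow> 'a \<Rightarrow> 'a set" where
  "pow_unit X n = (\<lambda>a \<in> ops X n. {a})"

definition pow_mult :: "'a operad_data \<Rightarrow> nat \<Rightarrow> 'a set set \<Rightarrow> 'a set" where
  "pow_mult X n = (\<lambda>\<A> \<in> ops (pow_operad (pow_operad X)) n. \<Union>\<A>)"

definition nepow_operad :: "'a operad_data \<Rightarrow> 'a set operad_data" where
  "nepow_operad X = (pow_operad X)\<lparr>ops := (\<lambda>n. Pow (ops X n) - {{}})\<rparr>"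

definition nepow_map :: "'a operad_data \<Rightarrow> (nat \<Rightarrow> 'a \<Rightarrow> 'b) \<Rightarrow> nat \<Rightarrow> 'a set \<Rightarrow> 'b set" where
  "nepow_map X f n = (\<lambda>A \<in> ops (nepow_operad X) n. f n ` A)"

definition nepow_unit :: "'a operad_data \<Rightarrow> nat \<Rightarrow> 'a \<Rightarrow> 'a set" where
  "nepow_unit X n = (\<lambda>a \<in> ops X n. {a})"

definition nepow_mult :: "'a operad_data \<Rightarrow> nat \<Rightarrow> 'a set set \<Rightarrow> 'a set" where
  "nepow_mult X n = (\<lambda>\<A> \<in> ops (nepow_operad (nepow_operad X)) n. \<Union>\<A>)"

end

theory Submission
  imports Defs
begin

text \<open>
  Every axiom of a set operad is an identity between two terms in which each operation variable
  occurs exactly once on either side.  Such a multilinear identity passes from elements to subsets,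
  because both sides, evaluated on subsets, are the set of all values on tuples of elements of
  these subsets.  So \<open>pow_operad X\<close> is again an operad, and the same argument applied to the
  equations of a morphism shows that direct images are morphisms.  (An identity with a
  repeated variable, such as \<open>x \<cdot> x = x\<close>, need not survive.)

  That \<open>\<A> \<mapsto> \<Union>\<A>\<close> is a morphism says that the lifted operations commute with arbitrary unions in each
  argument, and the monad laws are those of the powerset monad on sets, arity by arity.

  Omitting the empty set changes none of these equations; it only adds closure conditions: a
  composite, an image and a union of non-empty sets are non-empty, the last one since a non-empty
  family of non-empty sets has a non-empty union.  Both monads are therefore
  treated at once, through a truth value that says whether the empty set is admitted.
\<close>

section \<open>Operads of subsets\<close>

text \<open>
  The parameter is a truth value and not a predicate on sets, since it has to be used at the types of
  elements, sets and sets of sets simultaneously.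
\<close>

definition subset_operad :: "bool \<Rightarrow> 'a operad_data \<Rightarrow> 'a set operad_data" where
  "subset_operad e X = (pow_operad X)\<lparr>ops := (\<lambda>n. {A. A \<subseteq> ops X n \<and> (e \<or> A \<noteq> {})})\<rparr>"

definition subset_map ::
    "bool \<Rightarrow> 'a operad_data \<Rightarrow> (nat \<Rightarrow> 'a \<Rightarrow> 'b) \<Rightarrow> nat \<Rightarrow> 'a set \<Rightarrow> 'b set" where
  "subset_map e X f n = (\<lambda>A \<in> ops (subset_operad e X) n. f n ` A)"

definition subset_mult :: "bool \<Rightarrow> 'a operad_data \<Rightarrow> nat \<Rightarrow> 'a set set \<Rightarrow> 'a set" where
  "subset_mult e X n = (\<lambda>\<A> \<in> ops (subset_operad e (subset_operad e X)) n. \<Union>\<A>)"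

lemma pow_operad_eq: "pow_operad = subset_operad True"
  by (rule ext) (simp add: subset_operad_def pow_operad_def Pow_def)

lemma nepow_operad_eq: "nepow_operad = subset_operad False"
  by (rule ext) (auto simp: subset_operad_def nepow_operad_def pow_operad_def)

lemma pow_map_eq: "pow_map = subset_map True"
  by (intro ext) (simp add: subset_map_def pow_map_def pow_operad_eq)

lemma nepow_map_eq: "nepow_map = subset_map False"
  by (intro ext) (simp add: subset_map_def nepow_map_def nepow_operad_eq)

lemma pow_mult_eq: "pow_mult = subset_mult True"
  by (intro ext) (simp add: subset_mult_def pow_mult_def pow_operad_eq)

lemma nepow_mult_eq: "nepow_mult = subset_mult False"
  by (intro ext) (simp add: subset_mult_def nepow_mult_def nepow_operad_eq)

lemma nepow_unit_eq: "nepow_unit = pow_unit"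
  by (intro ext) (simp add: nepow_unit_def pow_unit_def)

lemma ops_subset_operad [simp]:
  "ops (subset_operad e X) n = {A. A \<subseteq> ops X n \<and> (e \<or> A \<noteq> {})}"
  by (simp add: subset_operad_def)

lemma act_subset_operad [simp]: "act (subset_operad e X) n A s = (\<lambda>a. act X n a s) ` A"
  by (simp add: subset_operad_def pow_operad_def)

lemma pcomp_subset_operad [simp]:
  "pcomp (subset_operad e X) n m i A B = {pcomp X n m i a b |a b. a \<in> A \<and> b \<in> B}"
  by (simp add: subset_operad_def pow_operad_def)

lemma ident_subset_operad [simp]: "ident (subset_operad e X) = {ident X}"
  by (simp add: subset_operad_def pow_operad_def)


section \<open>Lifting the operad axioms\<close>

lemma set_operadD:
  assumes "set_operad X"
  shows act_closed: "\<And>n a s. a \<in> ops X n \<Longrightarrow> s permutes {1..n} \<Longrightarrow> act X n a s \<in> ops X n"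
    and act_id: "\<And>n a. a \<in> ops X n \<Longrightarrow> act X n a id = a"
    and act_comp: "\<And>n a s t. a \<in> ops X n \<Longrightarrow> s permutes {1..n} \<Longrightarrow> t permutes {1..n} \<Longrightarrow>
        act X n a (s \<circ> t) = act X n (act X n a s) t"
    and ident_closed: "ident X \<in> ops X 1"
    and pcomp_closed: "\<And>n m i a b. i \<in> {1..n} \<Longrightarrow> a \<in> ops X n \<Longrightarrow> b \<in> ops X m \<Longrightarrow>
        pcomp X n m i a b \<in> ops X (n + m - 1)"
    and ident_left: "\<And>n a. a \<in> ops X n \<Longrightarrow> pcomp X 1 n 1 (ident X) a = a"
    and ident_right: "\<And>n i a. i \<in> {1..n} \<Longrightarrow> a \<in> ops X n \<Longrightarrow> pcomp X n 1 i a (ident X) = a"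
    and pcomp_seq: "\<And>n m l i j a b c. i \<in> {1..n} \<Longrightarrow> j \<in> {1..m} \<Longrightarrow>
        a \<in> ops X n \<Longrightarrow> b \<in> ops X m \<Longrightarrow> c \<in> ops X l \<Longrightarrow>
        pcomp X (n + m - 1) l (i + j - 1) (pcomp X n m i a b) c =
        pcomp X n (m + l - 1) i a (pcomp X m l j b c)"
    and pcomp_par: "\<And>n m l i k a b c. i \<in> {1..n} \<Longrightarrow> k \<in> {1..n} \<Longrightarrow> i < k \<Longrightarrow>
        a \<in> ops X n \<Longrightarrow> b \<in> ops X m \<Longrightarrow> c \<in> ops X l \<Longrightarrow>
        pcomp X (n + m - 1) l (k + m - 1) (pcomp X n m i a b) c =
        pcomp X (n + l - 1) m i (pcomp X n l k a c) b"
    and pcomp_act: "\<And>n m i a b s t. i \<in> {1..n} \<Longrightarrow> a \<in> ops X n \<Longrightarrow> b \<in> ops X m \<Longrightarrow>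
        s permutes {1..n} \<Longrightarrow> t permutes {1..m} \<Longrightarrow>
        pcomp X n m i (act X n a s) (act X m b t) =
        act X (n + m - 1) (pcomp X n m (s i) a b) (block_perm m i s t)"
  using assms unfolding set_operad_def by (meson)+

text \<open>
  These serve for the two associativity axioms and for equivariance; the third also shows that a
  direct image preserves compositions.  Each holds because every variable of the given identity
  occurs once on either side, so that both lifted sides are the set of its values over all
  independent choices of elements.
\<close>

lemma lift_seq:
  assumes "\<And>a b c. a \<in> A \<Longrightarrow> b \<in> B \<Longrightarrow> c \<in> C \<Longrightarrow> f (g a b) c = h a (k b c)"
  shows "{f x c |x c. x \<in> {g a b |a b. a \<in> A \<and> b \<in> B} \<and> c \<in> C} =
         {h a y |a y. a \<in> A \<and> y \<in> {k b c |b c. b \<in> B \<and> c \<in> C}}" (is "?L = ?R")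
proof -
  have "?L = {f (g a b) c |a b c. a \<in> A \<and> b \<in> B \<and> c \<in> C}" by blast
  also have "\<dots> = {h a (k b c) |a b c. a \<in> A \<and> b \<in> B \<and> c \<in> C}" using assms by metis
  also have "\<dots> = ?R" by blast
  finally show ?thesis .
qed

lemma lift_par:
  assumes "\<And>a b c. a \<in> A \<Longrightarrow> b \<in> B \<Longrightarrow> c \<in> C \<Longrightarrow> f (g a b) c = h (k a c) b"
  shows "{f x c |x c. x \<in> {g a b |a b. a \<in> A \<and> b \<in> B} \<and> c \<in> C} =
         {h y b |y b. y \<in> {k a c |a c. a \<in> A \<and> c \<in> C} \<and> b \<in> B}" (is "?L = ?R")
proof -
  have "?L = {f (g a b) c |a b c. a \<in> A \<and> b \<in> B \<and> c \<in> C}" by blast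
  also have "\<dots> = {h (k a c) b |a b c. a \<in> A \<and> b \<in> B \<and> c \<in> C}" using assms by metis
  also have "\<dots> = ?R" by blast
  finally show ?thesis .
qed

lemma lift_hom:
  assumes "\<And>a b. a \<in> A \<Longrightarrow> b \<in> B \<Longrightarrow> f (u a) (v b) = w (g a b)"
  shows "{f x y |x y. x \<in> u ` A \<and> y \<in> v ` B} = w ` {g a b |a b. a \<in> A \<and> b \<in> B}" (is "?L = ?R")
proof -
  have "?L = {f (u a) (v b) |a b. a \<in> A \<and> b \<in> B}" by blast
  also have "\<dots> = {w (g a b) |a b. a \<in> A \<and> b \<in> B}" using assms by metis
  also have "\<dots> = ?R" by blast
  finally show ?thesis .
qed

proposition set_operad_subset_operad:
  assumes X: "set_operad X"
  shows "set_operad (subset_operad e X)"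
  unfolding set_operad_def
proof (intro conjI allI ballI impI; (elim conjE)?)
  fix n A and s :: "nat \<Rightarrow> nat"
  assume A: "A \<in> ops (subset_operad e X) n" and s: "s permutes {1..n}"
  show "act (subset_operad e X) n A s \<in> ops (subset_operad e X) n"
    using A act_closed[OF X _ s] by auto
next
  fix n A assume A: "A \<in> ops (subset_operad e X) n"
  then have "a \<in> ops X n" if "a \<in> A" for a using that by auto
  then show "act (subset_operad e X) n A id = A"
    using act_id[OF X] by (simp cong: image_cong)
next
  fix n A and s t :: "nat \<Rightarrow> nat"
  assume A: "A \<in> ops (subset_operad e X) n"
    and s: "s permutes {1..n}" and t: "t permutes {1..n}"
  have "act X n a (s \<circ> t) = act X n (act X n a s) t" if "a \<in> A" for a
    using act_comp[OF X _ s t] A that by auto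
  then show "act (subset_operad e X) n A (s \<circ> t) =
      act (subset_operad e X) n (act (subset_operad e X) n A s) t"
    by (simp add: image_image cong: image_cong)
next
  show "ident (subset_operad e X) \<in> ops (subset_operad e X) 1"
    using ident_closed[OF X] by simp
next
  fix n m i A B
  assume i: "i \<in> {1..n}" and A: "A \<in> ops (subset_operad e X) n"
    and B: "B \<in> ops (subset_operad e X) m"
  show "pcomp (subset_operad e X) n m i A B \<in> ops (subset_operad e X) (n + m - 1)"
    using A B by (auto simp del: One_nat_def intro!: pcomp_closed[OF X i])
next
  fix n A assume A: "A \<in> ops (subset_operad e X) n"
  then have "pcomp X 1 n 1 (ident X) a = a" if "a \<in> A" for a
    using ident_left[OF X] that by auto
  then show "pcomp (subset_operad e X) 1 n 1 (ident (subset_operad e X)) A = A"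
    by (auto simp del: One_nat_def) metis
next
  fix n i A assume i: "i \<in> {1..n}" and A: "A \<in> ops (subset_operad e X) n"
  then have "pcomp X n 1 i a (ident X) = a" if "a \<in> A" for a
    using ident_right[OF X i] that by auto
  then show "pcomp (subset_operad e X) n 1 i A (ident (subset_operad e X)) = A"
    by (auto simp del: One_nat_def) metis
next
  fix n m l i j A B C
  assume i: "i \<in> {1..n}" and j: "j \<in> {1..m}" and A: "A \<in> ops (subset_operad e X) n"
    and B: "B \<in> ops (subset_operad e X) m" and C: "C \<in> ops (subset_operad e X) l"
  show "pcomp (subset_operad e X) (n + m - 1) l (i + j - 1) (pcomp (subset_operad e X) n m i A B) C =
        pcomp (subset_operad e X) n (m + l - 1) i A (pcomp (subset_operad e X) m l j B C)"
    unfolding pcomp_subset_operad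
    by (rule lift_seq, rule pcomp_seq[OF X i j]) (use A B C in auto)
next
  fix n m l i k A B C
  assume i: "i \<in> {1..n}" and k: "k \<in> {1..n}" and ik: "i < k"
    and A: "A \<in> ops (subset_operad e X) n"
    and B: "B \<in> ops (subset_operad e X) m" and C: "C \<in> ops (subset_operad e X) l"
  show "pcomp (subset_operad e X) (n + m - 1) l (k + m - 1) (pcomp (subset_operad e X) n m i A B) C =
        pcomp (subset_operad e X) (n + l - 1) m i (pcomp (subset_operad e X) n l k A C) B"
    unfolding pcomp_subset_operad
    by (rule lift_par, rule pcomp_par[OF X i k ik]) (use A B C in auto)
next
  fix n m i A B and s t :: "nat \<Rightarrow> nat"
  assume i: "i \<in> {1..n}" and A: "A \<in> ops (subset_operad e X) n"
    and B: "B \<in> ops (subset_operad e X) m"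
    and s: "s permutes {1..n}" and t: "t permutes {1..m}"
  show "pcomp (subset_operad e X) n m i (act (subset_operad e X) n A s) (act (subset_operad e X) m B t) =
        act (subset_operad e X) (n + m - 1) (pcomp (subset_operad e X) n m (s i) A B) (block_perm m i s t)"
    unfolding pcomp_subset_operad act_subset_operad
    by (rule lift_hom, rule pcomp_act[OF X i _ _ s t]) (use A B in auto)
qed


section \<open>Functoriality\<close>

lemma op_homI:
  assumes "\<And>n. f n \<in> ops X n \<rightarrow>\<^sub>E ops Y n"
    and "\<And>n a s. a \<in> ops X n \<Longrightarrow> s permutes {1..n} \<Longrightarrow> f n (act X n a s) = act Y n (f n a) s"
    and "f 1 (ident X) = ident Y"
    and "\<And>n m i a b. i \<in> {1..n} \<Longrightarrow> a \<in> ops X n \<Longrightarrow> b \<in> ops X m \<Longrightarrow>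
        f (n + m - 1) (pcomp X n m i a b) = pcomp Y n m i (f n a) (f m b)"
  shows "f \<in> op_hom X Y"
  unfolding op_hom_def using assms by blast

lemma op_homD:
  assumes "f \<in> op_hom X Y"
  shows hom_closed: "\<And>n a. a \<in> ops X n \<Longrightarrow> f n a \<in> ops Y n"
    and hom_act: "\<And>n a s. a \<in> ops X n \<Longrightarrow> s permutes {1..n} \<Longrightarrow>
        f n (act X n a s) = act Y n (f n a) s"
    and hom_ident: "f 1 (ident X) = ident Y"
    and hom_pcomp: "\<And>n m i a b. i \<in> {1..n} \<Longrightarrow> a \<in> ops X n \<Longrightarrow> b \<in> ops X m \<Longrightarrow>
        f (n + m - 1) (pcomp X n m i a b) = pcomp Y n m i (f n a) (f m b)"
  using assms unfolding op_hom_def by auto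

lemma subset_map_apply:
  "A \<in> ops (subset_operad e X) n \<Longrightarrow> subset_map e X f n A = f n ` A"
  by (simp add: subset_map_def)

lemma subset_mult_apply:
  "\<A> \<in> ops (subset_operad e (subset_operad e X)) n \<Longrightarrow> subset_mult e X n \<A> = \<Union>\<A>"
  by (simp add: subset_mult_def)

lemma op_compose_apply: "a \<in> ops X n \<Longrightarrow> op_compose X g f n a = g n (f n a)"
  by (simp add: op_compose_def compose_def)

lemma op_compose_eqI:
  assumes "\<And>n a. a \<in> ops X n \<Longrightarrow> g n (f n a) = g' n (f' n a)"
  shows "op_compose X g f = op_compose X g' f'"
  using assms by (auto simp: op_compose_def compose_def fun_eq_iff)

lemma op_compose_eq_idI:
  assumes "\<And>n a. a \<in> ops X n \<Longrightarrow> g n (f n a) = a"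
  shows "op_compose X g f = op_id X"
  using assms by (auto simp: op_compose_def op_id_def compose_def fun_eq_iff)

lemma subset_map_hom:
  assumes X: "set_operad X" and f: "f \<in> op_hom X Y"
  shows "subset_map e X f \<in> op_hom (subset_operad e X) (subset_operad e Y)"
proof (rule op_homI)
  note SX = set_operad_subset_operad[OF X, of e]
  show "subset_map e X f n \<in> ops (subset_operad e X) n \<rightarrow>\<^sub>E ops (subset_operad e Y) n" for n
    using hom_closed[OF f] by (auto simp: subset_map_def)
  show "subset_map e X f n (act (subset_operad e X) n A s) =
      act (subset_operad e Y) n (subset_map e X f n A) s"
    if A: "A \<in> ops (subset_operad e X) n" and s: "s permutes {1..n}" for n A s
  proof -
    have "f n (act X n a s) = act Y n (f n a) s" if "a \<in> A" for a
      using hom_act[OF f _ s] A that by auto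
    then show ?thesis
      unfolding subset_map_apply[OF A] subset_map_apply[OF act_closed[OF SX A s]]
      by (simp add: image_image cong: image_cong)
  qed
  show "subset_map e X f 1 (ident (subset_operad e X)) = ident (subset_operad e Y)"
    unfolding subset_map_apply[OF ident_closed[OF SX]]
    using hom_ident[OF f] by simp
  show "subset_map e X f (n + m - 1) (pcomp (subset_operad e X) n m i A B) =
      pcomp (subset_operad e Y) n m i (subset_map e X f n A) (subset_map e X f m B)"
    if i: "i \<in> {1..n}" and A: "A \<in> ops (subset_operad e X) n"
      and B: "B \<in> ops (subset_operad e X) m" for n m i A B
    unfolding subset_map_apply[OF A] subset_map_apply[OF B]
      subset_map_apply[OF pcomp_closed[OF SX i A B]]
    unfolding pcomp_subset_operad
    by (rule lift_hom[symmetric], rule hom_pcomp[OF f i, symmetric]) (use A B in auto)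
qed

lemma subset_map_id: "subset_map e X (op_id X) = op_id (subset_operad e X)"
  by (auto simp: subset_map_def op_id_def fun_eq_iff restrict_def image_iff)

lemma subset_map_compose:
  assumes f: "f \<in> op_hom X Y"
  shows "subset_map e X (op_compose X g f) =
    op_compose (subset_operad e X) (subset_map e Y g) (subset_map e X f)"
proof (intro ext)
  fix n A
  show "subset_map e X (op_compose X g f) n A =
    op_compose (subset_operad e X) (subset_map e Y g) (subset_map e X f) n A"
  proof (cases "A \<in> ops (subset_operad e X) n")
    case True
    then have "f n ` A \<in> ops (subset_operad e Y) n" and "\<And>a. a \<in> A \<Longrightarrow> a \<in> ops X n"
      using hom_closed[OF f] by auto
    then show ?thesis
      using True
      by (simp add: op_compose_apply subset_map_apply image_image del: ops_subset_operad cong: image_cong)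
  next
    case False
    then show ?thesis
      by (simp add: subset_map_def op_compose_def compose_def del: ops_subset_operad)
  qed
qed

proposition subset_endofunctor:
  "op_endofunctor (subset_operad e) (subset_operad e)
    (subset_map e) (subset_map e) (subset_map e) (subset_map e)"
  unfolding op_endofunctor_def
  by (blast intro: set_operad_subset_operad subset_map_hom subset_map_id subset_map_compose)


section \<open>Unit and multiplication\<close>

lemma pow_unit_hom:
  assumes X: "set_operad X"
  shows "pow_unit X \<in> op_hom X (subset_operad e X)"
proof (rule op_homI)
  show "pow_unit X n \<in> ops X n \<rightarrow>\<^sub>E ops (subset_operad e X) n" for n
    by (auto simp: pow_unit_def)
qed (simp_all add: pow_unit_def act_closed[OF X] ident_closed[OF X, simplified]
       pcomp_closed[OF X, simplified])

text \<open>
  A non-empty family of non-empty sets has a non-empty union, so \<open>\<Union>\<close> takes values in the right set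
  also when the empty set is excluded.
\<close>

lemma Union_closed:
  "\<A> \<in> ops (subset_operad e (subset_operad e X)) n \<Longrightarrow> \<Union>\<A> \<in> ops (subset_operad e X) n"
  by auto

text \<open>Compatibility with composition is bilinearity of the lifted composition over unions.\<close>

lemma subset_mult_hom:
  assumes X: "set_operad X"
  shows "subset_mult e X \<in> op_hom (subset_operad e (subset_operad e X)) (subset_operad e X)"
proof (rule op_homI)
  note SSX = set_operad_subset_operad[OF set_operad_subset_operad[OF X, of e], of e]
  show "subset_mult e X n \<in> ops (subset_operad e (subset_operad e X)) n \<rightarrow>\<^sub>E ops (subset_operad e X) n" for n
    unfolding subset_mult_def using Union_closed by (auto simp del: ops_subset_operad)
  show "subset_mult e X n (act (subset_operad e (subset_operad e X)) n \<A> s) =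
      act (subset_operad e X) n (subset_mult e X n \<A>) s"
    if A: "\<A> \<in> ops (subset_operad e (subset_operad e X)) n" and s: "s permutes {1..n}" for n \<A> s
    unfolding subset_mult_apply[OF A] subset_mult_apply[OF act_closed[OF SSX A s]] by auto
  show "subset_mult e X 1 (ident (subset_operad e (subset_operad e X))) = ident (subset_operad e X)"
    unfolding subset_mult_apply[OF ident_closed[OF SSX]] by simp
  show "subset_mult e X (n + m - 1) (pcomp (subset_operad e (subset_operad e X)) n m i \<A> \<B>) =
      pcomp (subset_operad e X) n m i (subset_mult e X n \<A>) (subset_mult e X m \<B>)"
    if i: "i \<in> {1..n}" and A: "\<A> \<in> ops (subset_operad e (subset_operad e X)) n"
      and B: "\<B> \<in> ops (subset_operad e (subset_operad e X)) m" for n m i \<A> \<B>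
    unfolding subset_mult_apply[OF A] subset_mult_apply[OF B]
      subset_mult_apply[OF pcomp_closed[OF SSX i A B]]
    unfolding pcomp_subset_operad by blast
qed

proposition pow_unit_natural:
  "op_nat_trans (\<lambda>X. X) (\<lambda>Y. Y) (\<lambda>X f. f)
    (subset_operad e) (subset_operad e) (subset_map e) pow_unit pow_unit"
  unfolding op_nat_trans_def
proof (intro conjI allI ballI impI pow_unit_hom; assumption?)
  fix X Y f assume "f \<in> op_hom X Y"
  then show "op_compose X (pow_unit Y) f = op_compose X (subset_map e X f) (pow_unit X)"
    by (intro op_compose_eqI) (simp add: pow_unit_def subset_map_def hom_closed)
qed

proposition subset_mult_natural:
  "op_nat_trans (\<lambda>X. subset_operad e (subset_operad e X)) (\<lambda>Y. subset_operad e (subset_operad e Y))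
    (\<lambda>X f. subset_map e (subset_operad e X) (subset_map e X f))
    (subset_operad e) (subset_operad e) (subset_map e) (subset_mult e) (subset_mult e)"
  unfolding op_nat_trans_def
proof (intro conjI allI ballI impI subset_mult_hom; assumption?; elim conjE)
  fix X :: "'a operad_data" and Y :: "'b operad_data" and f
  assume f: "f \<in> op_hom X Y" and X: "set_operad X"
  let ?S = "subset_operad e" and ?M = "subset_map e"
  note Mf = subset_map_hom[OF X f, of e]
  note MMf = subset_map_hom[OF set_operad_subset_operad[OF X] Mf, of e]
  show "op_compose (?S (?S X)) (subset_mult e Y) (?M (?S X) (?M X f)) =
      op_compose (?S (?S X)) (?M X f) (subset_mult e X)"
  proof (rule op_compose_eqI)
    fix n \<A> assume A: "\<A> \<in> ops (?S (?S X)) n"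
    then have *: "?M X f n A = f n ` A" if "A \<in> \<A>" for A
      using that by (intro subset_map_apply) auto
    have "subset_mult e Y n (?M (?S X) (?M X f) n \<A>) = \<Union>(?M X f n ` \<A>)"
      using subset_mult_apply[OF hom_closed[OF MMf A]] by (simp add: subset_map_apply[OF A])
    also have "\<dots> = f n ` \<Union>\<A>"
      using * by (simp add: image_Union)
    also have "\<dots> = ?M X f n (subset_mult e X n \<A>)"
      by (simp only: subset_mult_apply[OF A] subset_map_apply[OF Union_closed[OF A]])
    finally show "subset_mult e Y n (?M (?S X) (?M X f) n \<A>) = ?M X f n (subset_mult e X n \<A>)" .
  qed
qed

proposition subset_monad_laws:
  "op_monad_laws (subset_operad e) (subset_operad e) (subset_operad e) (subset_map e) (subset_map e)
    pow_unit pow_unit (subset_mult e) (subset_mult e)"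
  unfolding op_monad_laws_def
proof (intro allI impI conjI)
  fix X :: "'a operad_data" assume X: "set_operad X"
  let ?S = "subset_operad e" and ?M = "subset_map e" and ?mu = "subset_mult e"
  note SX = set_operad_subset_operad[OF X, of e]
  note SSX = set_operad_subset_operad[OF SX, of e]
  note muX = subset_mult_hom[OF X, of e]
  show "op_compose (?S (?S (?S X))) (?mu X) (?M (?S (?S X)) (?mu X)) =
      op_compose (?S (?S (?S X))) (?mu X) (?mu (?S X))"
  proof (rule op_compose_eqI)
    fix n \<C> assume C: "\<C> \<in> ops (?S (?S (?S X))) n"
    then have *: "?mu X n \<A> = \<Union>\<A>" if "\<A> \<in> \<C>" for \<A>
      using that by (intro subset_mult_apply) auto
    have "?mu X n (?M (?S (?S X)) (?mu X) n \<C>) = \<Union>(?mu X n ` \<C>)"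
      using subset_mult_apply[OF hom_closed[OF subset_map_hom[OF SSX muX] C]]
      by (simp add: subset_map_apply[OF C])
    also have "\<dots> = \<Union>(\<Union>\<C>)"
      using * by auto
    also have "\<dots> = ?mu X n (?mu (?S X) n \<C>)"
      using subset_mult_apply[OF C] subset_mult_apply[OF Union_closed[OF C]] by simp
    finally show "?mu X n (?M (?S (?S X)) (?mu X) n \<C>) = ?mu X n (?mu (?S X) n \<C>)" .
  qed
  show "op_compose (?S X) (?mu X) (?M X (pow_unit X)) = op_id (?S X)"
  proof (rule op_compose_eq_idI)
    fix n A assume A: "A \<in> ops (?S X) n"
    then have *: "pow_unit X n a = {a}" if "a \<in> A" for a
      using that by (auto simp: pow_unit_def)
    have "?mu X n (?M X (pow_unit X) n A) = \<Union>(pow_unit X n ` A)"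
      using subset_mult_apply[OF hom_closed[OF subset_map_hom[OF X pow_unit_hom[OF X]] A]]
      by (simp add: subset_map_apply[OF A])
    then show "?mu X n (?M X (pow_unit X) n A) = A"
      using * by simp
  qed
  show "op_compose (?S X) (?mu X) (pow_unit (?S X)) = op_id (?S X)"
  proof (rule op_compose_eq_idI)
    fix n A assume A: "A \<in> ops (?S X) n"
    then have "pow_unit (?S X) n A = {A}"
      by (simp add: pow_unit_def)
    then show "?mu X n (pow_unit (?S X) n A) = A"
      using subset_mult_apply[OF hom_closed[OF pow_unit_hom[OF SX, of e] A]] by simp
  qed
qed

theorem corollary2p10:
  shows "(op_endofunctor
      (pow_operad :: 'a operad_data \<Rightarrow> 'a set operad_data)
      (pow_operad :: 'b operad_data \<Rightarrow> 'b set operad_data)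
      (pow_map :: 'a operad_data \<Rightarrow> (nat \<Rightarrow> 'a \<Rightarrow> 'a) \<Rightarrow> nat \<Rightarrow> 'a set \<Rightarrow> 'a set)
      (pow_map :: 'a operad_data \<Rightarrow> (nat \<Rightarrow> 'a \<Rightarrow> 'b) \<Rightarrow> nat \<Rightarrow> 'a set \<Rightarrow> 'b set)
      (pow_map :: 'b operad_data \<Rightarrow> (nat \<Rightarrow> 'b \<Rightarrow> 'c) \<Rightarrow> nat \<Rightarrow> 'b set \<Rightarrow> 'c set)
      (pow_map :: 'a operad_data \<Rightarrow> (nat \<Rightarrow> 'a \<Rightarrow> 'c) \<Rightarrow> nat \<Rightarrow> 'a set \<Rightarrow> 'c set) \<and>
    op_nat_trans
      (\<lambda>X. X) (\<lambda>Y. Y) (\<lambda>X f. f)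
      pow_operad pow_operad pow_map
      (pow_unit :: 'a operad_data \<Rightarrow> nat \<Rightarrow> 'a \<Rightarrow> 'a set)
      (pow_unit :: 'b operad_data \<Rightarrow> nat \<Rightarrow> 'b \<Rightarrow> 'b set) \<and>
    op_nat_trans
      (\<lambda>X. pow_operad (pow_operad X)) (\<lambda>Y. pow_operad (pow_operad Y))
      (\<lambda>X f. pow_map (pow_operad X) (pow_map X f))
      pow_operad pow_operad pow_map
      (pow_mult :: 'a operad_data \<Rightarrow> nat \<Rightarrow> 'a set set \<Rightarrow> 'a set)
      (pow_mult :: 'b operad_data \<Rightarrow> nat \<Rightarrow> 'b set set \<Rightarrow> 'b set) \<and>
    op_monad_laws
      pow_operad pow_operad pow_operad pow_map pow_map
      (pow_unit :: 'a operad_data \<Rightarrow> nat \<Rightarrow> 'a \<Rightarrow> 'a set) pow_unit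
      (pow_mult :: 'a operad_data \<Rightarrow> nat \<Rightarrow> 'a set set \<Rightarrow> 'a set) pow_mult) \<and>
   (op_endofunctor
      (nepow_operad :: 'a operad_data \<Rightarrow> 'a set operad_data)
      (nepow_operad :: 'b operad_data \<Rightarrow> 'b set operad_data)
      (nepow_map :: 'a operad_data \<Rightarrow> (nat \<Rightarrow> 'a \<Rightarrow> 'a) \<Rightarrow> nat \<Rightarrow> 'a set \<Rightarrow> 'a set)
      (nepow_map :: 'a operad_data \<Rightarrow> (nat \<Rightarrow> 'a \<Rightarrow> 'b) \<Rightarrow> nat \<Rightarrow> 'a set \<Rightarrow> 'b set)
      (nepow_map :: 'b operad_data \<Rightarrow> (nat \<Rightarrow> 'b \<Rightarrow> 'c) \<Rightarrow> nat \<Rightarrow> 'b set \<Rightarrow> 'c set)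
      (nepow_map :: 'a operad_data \<Rightarrow> (nat \<Rightarrow> 'a \<Rightarrow> 'c) \<Rightarrow> nat \<Rightarrow> 'a set \<Rightarrow> 'c set) \<and>
    op_nat_trans
      (\<lambda>X. X) (\<lambda>Y. Y) (\<lambda>X f. f)
      nepow_operad nepow_operad nepow_map
      (nepow_unit :: 'a operad_data \<Rightarrow> nat \<Rightarrow> 'a \<Rightarrow> 'a set)
      (nepow_unit :: 'b operad_data \<Rightarrow> nat \<Rightarrow> 'b \<Rightarrow> 'b set) \<and>
    op_nat_trans
      (\<lambda>X. nepow_operad (nepow_operad X)) (\<lambda>Y. nepow_operad (nepow_operad Y))
      (\<lambda>X f. nepow_map (nepow_operad X) (nepow_map X f))
      nepow_operad nepow_operad nepow_map
      (nepow_mult :: 'a operad_data \<Rightarrow> nat \<Rightarrow> 'a set set \<Rightarrow> 'a set)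
      (nepow_mult :: 'b operad_data \<Rightarrow> nat \<Rightarrow> 'b set set \<Rightarrow> 'b set) \<and>
    op_monad_laws
      nepow_operad nepow_operad nepow_operad nepow_map nepow_map
      (nepow_unit :: 'a operad_data \<Rightarrow> nat \<Rightarrow> 'a \<Rightarrow> 'a set) nepow_unit
      (nepow_mult :: 'a operad_data \<Rightarrow> nat \<Rightarrow> 'a set set \<Rightarrow> 'a set) nepow_mult)"
  unfolding pow_operad_eq pow_map_eq pow_mult_eq
    nepow_operad_eq nepow_map_eq nepow_mult_eq nepow_unit_eq
  by (intro conjI subset_endofunctor pow_unit_natural subset_mult_natural subset_monad_laws)

end
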